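(* Let $G=(V,E)$ be a tree with $1<|V|<\infty$, let $a\in(0,\infty)^V$, $\beta>0$ and $q\in(0,\infty)^E$. The normalizing constant $c_K$ of the tree-Kummer distribution $\mathrm{TK}^G(a,\beta,q)$, i.e. the constant for which $$c_K\,\exp\bigl(-\beta\,\Delta^{\mathrm{Kum}}_G(k|q)\bigr)\prod_{v\in V}k_v^{a_v-1}\,\mathbf 1_{(0,\infty)^V}(k)$$ is a probability density with respect to Lebesgue measure on $\mathbb R^V$, has the form $$c_K=\Bigl(\prod_{v\in V}\frac{\beta^{a_v(1-d_v/2)}}{\Gamma(a_v)}\Bigr)\prod_{\{w,v\}\in E}\sqrt{\frac{q_{w,v}^{\,a_w+a_v}}{U\bigl(a_w,a_w-a_v+1,\beta/q_{w,v}\bigr)\,U\bigl(a_v,a_v-a_w+1,\beta/q_{w,v}\bigr)}},$$ where $d_v$ denotes the degree of the vertex $v\in V$ and $U(\cdot,\cdot,\cdot)$ is the Tricomi function.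
   Context: For $e=\{v,w\}\in E$ write $q_{v,w}=q_{w,v}=q_e$. For $W\subseteq V$ let $G_W=(W,E_W)$ be the induced subgraph of $G$ ($E_W$ is the set of edges of $G$ with both ends in $W$), $k^W=\prod_{v\in W}k_v$, $q^{E_W}=\prod_{e\in E_W}q_e$ (empty products equal $1$). Define $$\Delta^{\mathrm{Kum}}_G(k|q)=\sum_{\varnothing\ne W\subseteq V,\ G_W\text{ is a tree}}q^{E_W}k^W,$$ where a single vertex counts as a tree. The Tricomi function is, for $\alpha,z>0$ and $\gamma\in\mathbb R$, $$U(\alpha,\gamma,z)=\frac1{\Gamma(\alpha)}\int_0^\infty e^{-zt}t^{\alpha-1}(1+t)^{\gamma-\alpha-1}\,dt.$$ *)

theory Defs
  imports "HOL-Analysis.Analysis"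
begin

text \<open>
  Simple undirected graphs are given by a vertex set and a set of two-element subsets of it.
  AFP Graph_Theory is not used: there \<open>tree\<close> forbids directed cycles only, and in a symmetric
  digraph every edge already is a cycle \<open>a, b, a\<close>, so \<open>tree\<close> is not the undirected notion under
  either encoding.
\<close>

definition simple_graph :: "'v set \<Rightarrow> 'v set set \<Rightarrow> bool" where
  "simple_graph V E \<longleftrightarrow> (\<forall>e\<in>E. e \<subseteq> V \<and> card e = 2)"

definition induced_edges :: "'v set set \<Rightarrow> 'v set \<Rightarrow> 'v set set" where
  "induced_edges E W = {e \<in> E. e \<subseteq> W}"

definition vertex_degree :: "'v set set \<Rightarrow> 'v \<Rightarrow> nat" where
  "vertex_degree E v = card {e \<in> E. v \<in> e}"

definition graph_connected :: "'v set \<Rightarrow> 'v set set \<Rightarrow> bool" where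
  "graph_connected V E \<longleftrightarrow> V \<noteq> {} \<and> (\<forall>u\<in>V. \<forall>v\<in>V. (u, v) \<in> {(x, y). {x, y} \<in> E}\<^sup>*)"

definition graph_cycle :: "'v set set \<Rightarrow> 'v list \<Rightarrow> bool" where
  "graph_cycle E p \<longleftrightarrow> length p \<ge> 3 \<and> distinct p \<and>
     (\<forall>i<length p. {p ! i, p ! (Suc i mod length p)} \<in> E)"

definition is_tree :: "'v set \<Rightarrow> 'v set set \<Rightarrow> bool" where
  "is_tree V E \<longleftrightarrow> simple_graph V E \<and> graph_connected V E \<and> (\<nexists>p. graph_cycle E p)"

definition Delta_Kum :: "'v set \<Rightarrow> 'v set set \<Rightarrow> ('v set \<Rightarrow> real) \<Rightarrow> ('v \<Rightarrow> real) \<Rightarrow> real" where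
  "Delta_Kum V E q k =
     (\<Sum>W | W \<noteq> {} \<and> W \<subseteq> V \<and> is_tree W (induced_edges E W).
        (\<Prod>e\<in>induced_edges E W. q e) * (\<Prod>v\<in>W. k v))"

definition Tricomi_U :: "real \<Rightarrow> real \<Rightarrow> real \<Rightarrow> real" where
  "Tricomi_U \<alpha> \<gamma> z =
     1 / Gamma \<alpha> *
       (LINT t:{0<..}|lborel. exp (- z * t) * t powr (\<alpha> - 1) * (1 + t) powr (\<gamma> - \<alpha> - 1))"

text \<open>
  \<open>\<real>\<^sup>V\<close> with Lebesgue measure is the product space \<open>\<Pi>\<^sub>M v\<in>V. lborel\<close>, whose points are the
  functions that are \<open>undefined\<close> outside \<open>V\<close>.
\<close>

definition tree_Kummer_weight ::
  "'v set \<Rightarrow> 'v set set \<Rightarrow> ('v \<Rightarrow> real) \<Rightarrow> real \<Rightarrow> ('v set \<Rightarrow> real) \<Rightarrow> ('v \<Rightarrow> real) \<Rightarrow> real" where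
  "tree_Kummer_weight V E a \<beta> q k =
     exp (- \<beta> * Delta_Kum V E q k) * (\<Prod>v\<in>V. k v powr (a v - 1)) *
     indicator (\<Pi>\<^sub>E v\<in>V. {0<..}) k"

definition is_prob_density :: "'a measure \<Rightarrow> ('a \<Rightarrow> real) \<Rightarrow> bool" where
  "is_prob_density M f \<longleftrightarrow>
     f \<in> borel_measurable M \<and> (\<forall>x\<in>space M. 0 \<le> f x) \<and> (\<integral>\<^sup>+x. ennreal (f x) \<partial>M) = 1"

definition is_tree_Kummer_constant ::
  "'v set \<Rightarrow> 'v set set \<Rightarrow> ('v \<Rightarrow> real) \<Rightarrow> real \<Rightarrow> ('v set \<Rightarrow> real) \<Rightarrow> real \<Rightarrow> bool" where
  "is_tree_Kummer_constant V E a \<beta> q c \<longleftrightarrow>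
     is_prob_density (\<Pi>\<^sub>M v\<in>V. lborel) (\<lambda>k. c * tree_Kummer_weight V E a \<beta> q k)"

text \<open>
  The factor of an unordered edge is written with products over its elements;
  \<open>Kummer_edge_factor_doubleton\<close> below gives it in terms of the two end points.
\<close>

definition Kummer_edge_factor ::
  "('v \<Rightarrow> real) \<Rightarrow> real \<Rightarrow> ('v set \<Rightarrow> real) \<Rightarrow> 'v set \<Rightarrow> real" where
  "Kummer_edge_factor a \<beta> q e =
     sqrt (q e powr (\<Sum>v\<in>e. a v) /
           (\<Prod>w\<in>e. \<Prod>v\<in>e - {w}. Tricomi_U (a w) (a w - a v + 1) (\<beta> / q e)))"

lemma Kummer_edge_factor_doubleton:
  assumes "w \<noteq> v"
  shows "Kummer_edge_factor a \<beta> q {w, v} =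
    sqrt (q {w, v} powr (a w + a v) /
          (Tricomi_U (a w) (a w - a v + 1) (\<beta> / q {w, v}) *
           Tricomi_U (a v) (a v - a w + 1) (\<beta> / q {w, v})))"
proof -
  have "{w, v} - {w} = {v}" "{w, v} - {v} = {w}"
    using assms by auto
  then show ?thesis
    using assms by (simp add: Kummer_edge_factor_def)
qed

end

theory Submission
  imports Defs
begin

text \<open>
  Let \<open>l\<close> be a leaf attached to \<open>p\<close>. A subtree through \<open>p\<close> may or may not be extended by \<open>l\<close>, so
  \<open>\<Delta>\<close> of the tree is \<open>k\<^sub>l\<close> plus \<open>\<Delta>\<close> of the tree without \<open>l\<close>, with \<open>k\<^sub>p\<close> replaced by
  \<open>(1 + q k\<^sub>l) k\<^sub>p\<close>. Rescaling \<open>k\<^sub>p\<close> splits off the one-dimensional integral of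
  \<open>exp (- \<beta> t) t\<^bsup>a\<^sub>l - 1\<^esup> (1 + q t)\<^bsup>- a\<^sub>p\<^esup>\<close>, a Tricomi function, and induction over leaves gives the
  normalizing constant. It takes the symmetric form by Kummer's transformation of \<open>U\<close>.
\<close>

section \<open>Trees and their subtrees\<close>

lemma graph_cycle_mono:
  assumes "graph_cycle E c" and "E \<subseteq> F"
  shows "graph_cycle F c"
  using assms unfolding graph_cycle_def by blast

text \<open>The two neighbours are the predecessor and the successor on the cycle, which differ
  because a cycle has at least three vertices. Hence a vertex with a single neighbour lies on no
  cycle.\<close>

lemma graph_cycle_two_neighbours:
  assumes "graph_cycle E c" and "x \<in> set c"
  obtains u v where "u \<noteq> v" and "{x, u} \<in> E" and "{x, v} \<in> E"
proof -
  define n where "n = length c"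
  obtain i where i: "i < n" "c ! i = x"
    using assms(2) by (auto simp: in_set_conv_nth n_def)
  have n: "3 \<le> n" and "distinct c"
    and edges: "\<And>j. j < n \<Longrightarrow> {c ! j, c ! (Suc j mod n)} \<in> E"
    using assms(1) by (auto simp: graph_cycle_def n_def)
  \<comment> \<open>Positions before and after \<open>i\<close>, with wraparound;
    \<open>3 \<le> n\<close> keeps them apart.\<close>
  define j where "j = (if i = 0 then n - 1 else i - 1)"
  define m where "m = (if Suc i = n then 0 else Suc i)"
  have j: "j < n" "Suc j mod n = i" and m: "m < n" "Suc i mod n = m" and "j \<noteq> m"
    using i(1) n by (auto simp: j_def m_def)
  show thesis
  proof
    show "c ! j \<noteq> c ! m"
      using \<open>distinct c\<close> j m \<open>j \<noteq> m\<close> by (simp add: nth_eq_iff_index_eq n_def)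
    show "{x, c ! j} \<in> E"
      using edges[OF j(1)] i(2) j(2) by (simp add: insert_commute)
    show "{x, c ! m} \<in> E"
      using edges[OF i(1)] i(2) m(2) by simp
  qed
qed

text \<open>In the larger graph \<open>l\<close> has no neighbour but \<open>p\<close>, so a cycle
  avoids \<open>l\<close>, and with it the new edge.\<close>

lemma graph_cycle_pendant_edge_iff:
  assumes "\<forall>e\<in>E. l \<notin> e"
  shows "graph_cycle (insert {l, p} E) c \<longleftrightarrow> graph_cycle E c"
proof
  assume c: "graph_cycle (insert {l, p} E) c"
  have "l \<notin> set c"
  proof
    assume "l \<in> set c"
    then obtain u v where "u \<noteq> v" "{l, u} \<in> insert {l, p} E" "{l, v} \<in> insert {l, p} E"
      using graph_cycle_two_neighbours[OF c] by metis
    then show False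
      using assms by (auto simp: doubleton_eq_iff)
  qed
  have "{c ! i, c ! (Suc i mod length c)} \<in> E" if "i < length c" for i
  proof -
    have "Suc i mod length c < length c"
      using that by (intro mod_less_divisor) auto
    then have "c ! i \<noteq> l" "c ! (Suc i mod length c) \<noteq> l"
      using that \<open>l \<notin> set c\<close> nth_mem by metis+
    moreover have "{c ! i, c ! (Suc i mod length c)} \<in> insert {l, p} E"
      using c that by (simp add: graph_cycle_def)
    ultimately show ?thesis
      by (auto simp: doubleton_eq_iff)
  qed
  then show "graph_cycle E c"
    using c by (simp add: graph_cycle_def)
qed (auto intro: graph_cycle_mono)

lemma simple_graph_pendant_edge:
  assumes "simple_graph W F" and "l \<notin> W" and "p \<in> W"
  shows "simple_graph (insert l W) (insert {l, p} F)"
  using assms unfolding simple_graph_def by (auto simp: card_2_iff)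

lemma simple_graph_subset:
  assumes "simple_graph V E" and "e \<in> E"
  shows "e \<subseteq> V"
  using assms by (simp add: simple_graph_def)

lemma simple_graph_finite_edges:
  assumes "simple_graph V E" and "finite V"
  shows "finite E"
  using assms by (intro finite_subset[of E "Pow V"]) (auto simp: simple_graph_def)

text \<open>Contracting \<open>l\<close> to \<open>p\<close> turns a walk of the larger graph into a
  walk of the smaller one. Conversely, \<open>l\<close> is reached through \<open>p\<close>.\<close>

lemma graph_connected_pendant_edge_iff:
  assumes "\<forall>e\<in>F. l \<notin> e" and "l \<notin> W" and "p \<in> W"
  shows "graph_connected (insert l W) (insert {l, p} F) \<longleftrightarrow> graph_connected W F"
proof -
  define R where "R = {(x, y). {x, y} \<in> F}"
  define S where "S = {(x, y). {x, y} \<in> insert {l, p} F}"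
  have "R \<subseteq> S"
    by (auto simp: R_def S_def)
  have lp: "(l, p) \<in> S" "(p, l) \<in> S"
    by (auto simp: S_def insert_commute)
  define f where "f x = (if x = l then p else x)" for x
  \<comment> \<open>The pendant edge collapses to the trivial walk at \<open>p\<close>; every other
    edge is left alone.\<close>
  have step: "(f x, f y) \<in> R\<^sup>*" if "(x, y) \<in> S" for x y
    using that assms(1) by (auto simp: f_def S_def R_def doubleton_eq_iff)
  have contract: "(f x, f y) \<in> R\<^sup>*" if "(x, y) \<in> S\<^sup>*" for x y
    using that by induction (auto dest: step)
  show ?thesis
    unfolding graph_connected_def R_def[symmetric] S_def[symmetric]
  proof (intro iffI conjI; elim conjE)
    assume *: "\<forall>u\<in>insert l W. \<forall>v\<in>insert l W. (u, v) \<in> S\<^sup>*"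
    show "\<forall>u\<in>W. \<forall>v\<in>W. (u, v) \<in> R\<^sup>*"
    proof (intro ballI)
      fix u v assume uv: "u \<in> W" "v \<in> W"
      then have "(f u, f v) \<in> R\<^sup>*"
        using * contract by blast
      then show "(u, v) \<in> R\<^sup>*"
        using uv \<open>l \<notin> W\<close> by (auto simp: f_def split: if_splits)
    qed
  next
    assume "\<forall>u\<in>W. \<forall>v\<in>W. (u, v) \<in> R\<^sup>*"
    then have *: "(u, v) \<in> S\<^sup>*" if "u \<in> W" "v \<in> W" for u v
      using that rtrancl_mono[OF \<open>R \<subseteq> S\<close>] by blast
    have "(l, v) \<in> S\<^sup>*" if "v \<in> W" for v
      using *[OF \<open>p \<in> W\<close> that] lp(1) by (rule converse_rtrancl_into_rtrancl[rotated])
    moreover have "(u, l) \<in> S\<^sup>*" if "u \<in> W" for u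
      using *[OF that \<open>p \<in> W\<close>] lp(2) by (rule rtrancl_into_rtrancl)
    ultimately show "\<forall>u\<in>insert l W. \<forall>v\<in>insert l W. (u, v) \<in> S\<^sup>*"
      using * by simp
  qed (use assms in auto)
qed

lemma is_tree_pendant_edge_iff:
  assumes "simple_graph W F" and "l \<notin> W" and "p \<in> W"
  shows "is_tree (insert l W) (insert {l, p} F) \<longleftrightarrow> is_tree W F"
proof -
  have "\<forall>e\<in>F. l \<notin> e"
    using assms simple_graph_subset by blast
  then show ?thesis
    using assms simple_graph_pendant_edge[OF assms]
    by (simp add: is_tree_def graph_connected_pendant_edge_iff graph_cycle_pendant_edge_iff)
qed

lemma is_tree_singleton: "is_tree {v} {}"
proof -
  have "\<not> graph_cycle {} p" for p :: "'a list"
    by (cases p) (auto simp: graph_cycle_def)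
  then show ?thesis
    by (auto simp: is_tree_def simple_graph_def graph_connected_def)
qed

text \<open>A walk from \<open>l\<close> to another vertex would have to start with an edge
  containing \<open>l\<close>. This excludes the vertex sets that contain a leaf and other vertices,
  but not the neighbour of the leaf.\<close>

lemma not_is_tree_isolated:
  assumes "\<forall>e\<in>F. l \<notin> e" and "l \<notin> W" and "W \<noteq> {}"
  shows "\<not> is_tree (insert l W) F"
proof
  assume "is_tree (insert l W) F"
  moreover obtain w where "w \<in> W"
    using assms(3) by blast
  ultimately have "(l, w) \<in> {(x, y). {x, y} \<in> F}\<^sup>*"
    by (simp add: is_tree_def graph_connected_def)
  then show False
    using assms(1,2) \<open>w \<in> W\<close> by (cases rule: converse_rtranclE) auto
qed

text \<open>An end of a longest path is a leaf.\<close>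

lemma is_tree_leaf:
  assumes "finite V" and "1 < card V" and "is_tree V E"
  obtains l p where "l \<in> V" and "p \<in> V" and "l \<noteq> p" and "{e \<in> E. l \<in> e} = {{l, p}}"
proof -
  have simple: "simple_graph V E" and conn: "graph_connected V E"
    and acyclic: "\<nexists>c. graph_cycle E c"
    using assms(3) by (simp_all add: is_tree_def)
  have edge: "u \<in> V \<and> w \<in> V \<and> u \<noteq> w" if "{u, w} \<in> E" for u w
  proof -
    have "{u, w} \<subseteq> V" "card {u, w} = 2"
      using simple that unfolding simple_graph_def by blast+
    then show ?thesis
      by (cases "u = w") auto
  qed
  define P where "P c \<longleftrightarrow> distinct c \<and> set c \<subseteq> V \<and> successively (\<lambda>x y. {x, y} \<in> E) c" for c
  \<comment> \<open>Vertices of a path are distinct, so path lengths are bounded and a longest path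
    exists.\<close>
  have bound: "length c < Suc (card V)" if "P c" for c
    using that assms(1) by (metis P_def card_mono distinct_card le_imp_less_Suc)
  obtain u v where "u \<in> V" "v \<in> V" "u \<noteq> v"
    using assms(1,2) by (metis card_le_Suc0_iff_eq One_nat_def leD)
  then have "(u, v) \<in> {(x, y). {x, y} \<in> E}\<^sup>*"
    using conn by (simp add: graph_connected_def)
  then obtain w where "{u, w} \<in> E"
    using \<open>u \<noteq> v\<close> by (cases rule: converse_rtranclE) auto
  then have "P [u, w]"
    using edge by (auto simp: P_def)
  then obtain c where c: "P c" and max: "\<And>d. P d \<Longrightarrow> length d \<le> length c"
    using ex_has_greatest_nat[of P "[u, w]" length "Suc (card V)"] bound by blast
  have "2 \<le> length c"
    using max[OF \<open>P [u, w]\<close>] by simp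
  then obtain l p cs where c_eq: "c = l # p # cs"
    by (metis Suc_le_length_iff numeral_2_eq_2)
  have only: "e = {l, p}" if e: "e \<in> E" "l \<in> e" for e
  proof -
    obtain x where x: "e = {l, x}"
      using e simple by (auto simp: simple_graph_def card_2_iff doubleton_eq_iff)
    have "x \<in> V" "x \<noteq> l"
      using edge e(1) x by blast+
    show ?thesis
    proof (cases "x \<in> set c")
      \<comment> \<open>A neighbour of \<open>l\<close> off the path could be put in front of it,
        against maximality.\<close>
      case False
      then have "P (x # c)"
        using c \<open>x \<in> V\<close> e(1) x by (simp add: P_def c_eq insert_commute)
      then show ?thesis
        using max[of "x # c"] by simp
    next
      case True
      then obtain j where j: "j < length c" "c ! j = x"
        by (auto simp: in_set_conv_nth)
      have "j \<noteq> 0"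
        using j(2) \<open>x \<noteq> l\<close> by (metis c_eq nth_Cons_0)
      \<comment> \<open>A neighbour at position \<open>j \<ge> 2\<close> closes the first
        \<open>Suc j\<close> vertices of the path to a cycle; the closing edge, at index
        \<open>j\<close>, is \<open>e\<close> itself.\<close>
      have "j < 2"
      proof (rule ccontr)
        assume "\<not> j < 2"
        have nth: "take (Suc j) c ! m = c ! m" if "m < Suc j" for m
          using that by simp
        have "{take (Suc j) c ! i, take (Suc j) c ! (Suc i mod Suc j)} \<in> E" if "i < Suc j" for i
        proof (cases "i = j")
          case True
          then show ?thesis
            using e(1) x j(2) nth[of j] nth[of 0] c_eq by (simp add: insert_commute)
        next
          case False
          then have "Suc i < length c" "Suc i < Suc j"
            using that j(1) by auto
          then show ?thesis
            using c nth[of i] nth[of "Suc i"] by (simp add: P_def successively_conv_nth)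
        qed
        moreover have "length (take (Suc j) c) = Suc j"
          using j(1) by simp
        ultimately have "graph_cycle E (take (Suc j) c)"
          using c \<open>\<not> j < 2\<close> by (simp add: graph_cycle_def P_def)
        then show False
          using acyclic by blast
      qed
      then have "j = 1"
        using \<open>j \<noteq> 0\<close> by simp
      then show ?thesis
        using j(2) x by (simp add: c_eq)
    qed
  qed
  have lp: "{l, p} \<in> E"
    using c by (simp add: P_def c_eq)
  have "{e \<in> E. l \<in> e} = {{l, p}}"
  proof (intro equalityI subsetI)
    show "e \<in> {{l, p}}" if "e \<in> {e \<in> E. l \<in> e}" for e
      using only[of e] that by simp
  qed (use lp in auto)
  then show thesis
    using that[of l p] edge[OF lp] by simp
qed

text \<open>Every tree with more than one vertex has a leaf, and removing it leaves a tree; strong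
  induction on the number of vertices then reaches a single vertex.\<close>

lemma tree_induct [consumes 2, case_names singleton pendant]:
  assumes "finite V" and "is_tree V E"
    and singleton: "\<And>v. P {v} {}"
    and pendant: "\<And>l p V E. finite V \<Longrightarrow> is_tree V E \<Longrightarrow> l \<notin> V \<Longrightarrow> p \<in> V \<Longrightarrow> P V E \<Longrightarrow>
      P (insert l V) (insert {l, p} E)"
  shows "P V E"
  using assms(1,2)
proof (induction "card V" arbitrary: V E rule: less_induct)
  case less
  have "V \<noteq> {}" and simple: "simple_graph V E"
    using less.prems(2) by (auto simp: is_tree_def graph_connected_def)
  show ?case
  proof (cases "1 < card V")
    case False
    then obtain v where V: "V = {v}"
      using \<open>V \<noteq> {}\<close> less.prems(1) by (metis card_0_eq card_1_singletonE less_one linorder_neqE_nat)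
    have "E = {}"
    proof (rule equals0I)
      fix e assume "e \<in> E"
      then have "e \<subseteq> {v}" "card e = 2"
        using simple V by (auto simp: simple_graph_def)
      then show False
        using card_mono[of "{v}" e] by simp
    qed
    then show ?thesis
      using V singleton by simp
  next
    case True
    then obtain l p where lp: "l \<in> V" "p \<in> V" "l \<noteq> p" and leaf: "{e \<in> E. l \<in> e} = {{l, p}}"
      using is_tree_leaf less.prems by metis
    define W where "W = V - {l}"
    define F where "F = E - {{l, p}}"
    have V: "V = insert l W" and E: "E = insert {l, p} F" and W: "l \<notin> W" "p \<in> W"
      using lp leaf by (auto simp: W_def F_def)
    have "l \<notin> e" if "e \<in> F" for e
      using that leaf by (auto simp: F_def)
    then have "simple_graph W F"
      using simple by (auto simp: simple_graph_def W_def F_def)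
    then have "is_tree W F"
      using is_tree_pendant_edge_iff W less.prems(2) V E by metis
    have "finite W"
      using less.prems(1) by (simp add: W_def)
    have "card W < card V"
      unfolding W_def using lp(1) less.prems(1) by (rule card_Diff1_less[rotated])
    then have "P W F"
      using less.hyps \<open>finite W\<close> \<open>is_tree W F\<close> by blast
    then show ?thesis
      unfolding V E using \<open>finite W\<close> \<open>is_tree W F\<close> W by (intro pendant)
  qed
qed

section \<open>Subtrees and the polynomial \<open>Delta_Kum\<close> under attaching a leaf\<close>

text \<open>A subtree that avoids \<open>l\<close> is an old one. If it contains \<open>l\<close>
  and a further vertex, connectedness forces \<open>p\<close> into it, and deleting the leaf
  \<open>l\<close> leaves an old subtree through \<open>p\<close>.\<close>

lemma subtrees_pendant_edge:
  assumes "simple_graph V E" and "l \<notin> V" and "p \<in> V"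
  defines "T \<equiv> {W. W \<noteq> {} \<and> W \<subseteq> V \<and> is_tree W (induced_edges E W)}"
  shows "{W. W \<noteq> {} \<and> W \<subseteq> insert l V \<and> is_tree W (induced_edges (insert {l, p} E) W)} =
    insert {l} (T \<union> insert l ` {W \<in> T. p \<in> W})"
proof -
  let ?E = "insert {l, p} E"
  define L where "L = {W. W \<noteq> {} \<and> W \<subseteq> insert l V \<and> is_tree W (induced_edges ?E W)}"
  have l: "l \<notin> e" if "e \<in> E" for e
    using that assms(2) simple_graph_subset[OF assms(1)] by blast
  have simple: "simple_graph W (induced_edges E W)" for W
    using assms(1) by (simp add: simple_graph_def induced_edges_def)
  \<comment> \<open>The case \<open>W = {}\<close> stands apart because \<open>T\<close> excludes
    the empty set; it accounts for the subtree \<open>{l}\<close>.\<close>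
  have ins: "insert l W \<in> L \<longleftrightarrow> W = {} \<or> W \<in> T \<and> p \<in> W" if "W \<subseteq> V" for W
  proof -
    have lW: "l \<notin> W"
      using that assms(2) by blast
    have iso: "\<forall>e\<in>induced_edges E W. l \<notin> e"
      using l by (simp add: induced_edges_def)
    have L: "insert l W \<in> L \<longleftrightarrow> is_tree (insert l W) (induced_edges ?E (insert l W))"
      using that by (auto simp: L_def)
    show ?thesis
    proof (cases "p \<in> W")
      case True
      then have "induced_edges ?E (insert l W) = insert {l, p} (induced_edges E W)"
        using l by (auto simp: induced_edges_def)
      then show ?thesis
        using L that True is_tree_pendant_edge_iff[OF simple lW True] by (auto simp: T_def)
    next
      case False
      then have *: "induced_edges ?E (insert l W) = induced_edges E W"
        using l assms(2,3) by (auto simp: induced_edges_def)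
      show ?thesis
      proof (cases "W = {}")
        case True
        have "induced_edges E {} = {}"
          using assms(1) by (auto simp: induced_edges_def simple_graph_def)
        then show ?thesis
          using L * True is_tree_singleton[of l] by simp
      next
        case nonempty: False
        then show ?thesis
          using L * False not_is_tree_isolated[OF iso lW nonempty] by simp
      qed
    qed
  qed
  have no: "W \<in> L \<longleftrightarrow> W \<in> T" if "l \<notin> W" for W
  proof -
    have "induced_edges ?E W = induced_edges E W"
      using that by (auto simp: induced_edges_def)
    then show ?thesis
      using that by (auto simp: L_def T_def)
  qed
  have T: "W \<subseteq> V" if "W \<in> T" for W
    using that by (simp add: T_def)
  have L: "W \<subseteq> insert l V" if "W \<in> L" for W
    using that by (simp add: L_def)
  have "L = insert {l} (T \<union> insert l ` {W \<in> T. p \<in> W})"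
  proof (intro set_eqI iffI)
    fix W assume W: "W \<in> L"
    show "W \<in> insert {l} (T \<union> insert l ` {W \<in> T. p \<in> W})"
    proof (cases "l \<in> W")
      case True
      define X where "X = W - {l}"
      have X: "W = insert l X" "X \<subseteq> V"
        using True L[OF W] by (auto simp: X_def)
      then have "X = {} \<or> X \<in> T \<and> p \<in> X"
        using ins W by simp
      then show ?thesis
        using X(1) by blast
    next
      case False
      then show ?thesis
        using no W by simp
    qed
  next
    fix W assume "W \<in> insert {l} (T \<union> insert l ` {W \<in> T. p \<in> W})"
    then consider "W = {l}" | "W \<in> T" | X where "W = insert l X" "X \<in> T" "p \<in> X"
      by blast
    then show "W \<in> L"
    proof cases
      case 1
      then show ?thesis
        using ins[of "{}"] by simp
    next
      case 2
      then show ?thesis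
        using no[of W] T[of W] assms(2) by blast
    next
      case 3
      then show ?thesis
        using ins[of X] T[of X] by simp
    qed
  qed
  then show ?thesis
    by (simp add: L_def)
qed

text \<open>
  Attaching a leaf \<open>l\<close> to \<open>p\<close> amounts to rescaling the variable at \<open>p\<close>: each subtree through \<open>p\<close>
  occurs once without and once with \<open>l\<close>.
\<close>

lemma Delta_Kum_pendant_edge:
  assumes "finite V" and "simple_graph V E" and "l \<notin> V" and "p \<in> V"
  shows "Delta_Kum (insert l V) (insert {l, p} E) q k =
    k l + Delta_Kum V E q (k(p := (1 + q {l, p} * k l) * k p))"
proof -
  let ?E = "insert {l, p} E"
  define T where "T = {W. W \<noteq> {} \<and> W \<subseteq> V \<and> is_tree W (induced_edges E W)}"
  define f where "f F h W = (\<Prod>e\<in>induced_edges F W. q e) * (\<Prod>v\<in>W. h v)" for F and h :: "'a \<Rightarrow> real" and W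
  let ?c = "q {l, p} * k l"
  let ?h = "k(p := (1 + ?c) * k p)"
  have l: "\<forall>e\<in>E. l \<notin> e"
    using assms(2,3) simple_graph_subset[OF assms(2)] by blast
  have finT: "finite T"
    using assms(1) by (auto simp: T_def)
  have T: "W \<subseteq> V" "l \<notin> W" "finite W" if "W \<in> T" for W
    using that assms(1,3) finite_subset[of W V] by (auto simp: T_def)
  have finE: "finite (induced_edges E W)" for W
    using simple_graph_finite_edges[OF assms(2,1)] by (simp add: induced_edges_def)
  have "induced_edges ?E {l} = {}"
    using l assms(2-4) by (auto simp: induced_edges_def simple_graph_def subset_singleton_iff)
  then have f_l: "f ?E k {l} = k l"
    by (simp add: f_def)
  have f_off: "f ?E k W = f E k W" if "W \<in> T" for W
  proof -
    have "induced_edges ?E W = induced_edges E W"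
      using T[OF that] by (auto simp: induced_edges_def)
    then show ?thesis
      by (simp add: f_def)
  qed
  have f_on: "f ?E k (insert l W) = ?c * f E k W" if "W \<in> T" "p \<in> W" for W
  proof -
    have "induced_edges ?E (insert l W) = insert {l, p} (induced_edges E W)"
      using that l by (auto simp: induced_edges_def)
    moreover have "{l, p} \<notin> induced_edges E W"
      using l by (auto simp: induced_edges_def)
    ultimately show ?thesis
      using T[OF that(1)] finE[of W] by (simp add: f_def)
  qed
  \<comment> \<open>The monomial of a subtree through \<open>p\<close> is linear in
    \<open>k p\<close>. Rescaling adds \<open>?c\<close> times that monomial, which is the summand
    of the subtree extended by \<open>l\<close>.\<close>
  have f_scale: "f E ?h W = f E k W + (if p \<in> W then ?c * f E k W else 0)" if "W \<in> T" for W
  proof (cases "p \<in> W")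
    case True
    have "(\<Prod>v\<in>W. ?h v) = ?h p * (\<Prod>v\<in>W - {p}. ?h v)"
      using T[OF that] True by (simp add: prod.remove)
    also have "(\<Prod>v\<in>W - {p}. ?h v) = (\<Prod>v\<in>W - {p}. k v)"
      by (intro prod.cong) auto
    also have "?h p * \<dots> = (1 + ?c) * (\<Prod>v\<in>W. k v)"
      using T[OF that] True by (simp add: prod.remove)
    finally show ?thesis
      using True by (simp add: f_def algebra_simps)
  next
    case False
    then have "(\<Prod>v\<in>W. ?h v) = (\<Prod>v\<in>W. k v)"
      by (intro prod.cong) auto
    then show ?thesis
      using False by (simp add: f_def)
  qed
  have inj: "inj_on (insert l) {W \<in> T. p \<in> W}"
    using T by (intro inj_onI) (metis (no_types, lifting) insert_ident mem_Collect_eq)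
  have "Delta_Kum (insert l V) ?E q k = (\<Sum>W\<in>insert {l} (T \<union> insert l ` {W \<in> T. p \<in> W}). f ?E k W)"
    unfolding Delta_Kum_def f_def subtrees_pendant_edge[OF assms(2-4)] T_def ..
  also have "\<dots> = k l + (\<Sum>W\<in>T \<union> insert l ` {W \<in> T. p \<in> W}. f ?E k W)"
  proof (subst sum.insert)
    \<comment> \<open>Sets in \<open>T\<close> avoid \<open>l\<close>, and the extended ones contain
      \<open>p\<close>, which differs from \<open>l\<close>.\<close>
    show "{l} \<notin> T \<union> insert l ` {W \<in> T. p \<in> W}"
      using T(2)[of "{l}"] assms(3,4) T(1)[of "{}"] by (auto simp: insert_eq_iff)
  qed (use finT f_l in auto)
  also have "(\<Sum>W\<in>T \<union> insert l ` {W \<in> T. p \<in> W}. f ?E k W) =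
      (\<Sum>W\<in>T. f ?E k W) + (\<Sum>W\<in>insert l ` {W \<in> T. p \<in> W}. f ?E k W)"
    using finT T(2) by (intro sum.union_disjoint) auto
  also have "(\<Sum>W\<in>insert l ` {W \<in> T. p \<in> W}. f ?E k W) = (\<Sum>W\<in>{W \<in> T. p \<in> W}. f ?E k (insert l W))"
    using inj by (simp add: sum.reindex)
  also have "\<dots> = (\<Sum>W\<in>{W \<in> T. p \<in> W}. ?c * f E k W)"
    using f_on by (intro sum.cong) auto
  also have "\<dots> = (\<Sum>W\<in>T. if p \<in> W then ?c * f E k W else 0)"
    using finT by (simp add: sum.inter_filter)
  also have "(\<Sum>W\<in>T. f ?E k W) = (\<Sum>W\<in>T. f E k W)"
    using f_off by (rule sum.cong[OF refl])
  also have "\<dots> + (\<Sum>W\<in>T. if p \<in> W then ?c * f E k W else 0) = (\<Sum>W\<in>T. f E ?h W)"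
    unfolding sum.distrib[symmetric] using f_scale by (intro sum.cong) auto
  also have "\<dots> = Delta_Kum V E q ?h"
    by (simp add: Delta_Kum_def T_def f_def)
  finally show ?thesis .
qed

lemma Delta_Kum_singleton: "Delta_Kum {v} {} q k = k v"
proof -
  have "{W. W \<noteq> {} \<and> W \<subseteq> {v} \<and> is_tree W (induced_edges {} W)} = {{v}}"
    using is_tree_singleton[of v] by (auto simp: induced_edges_def)
  then show ?thesis
    by (simp add: Delta_Kum_def induced_edges_def)
qed

section \<open>Tricomi integrals\<close>

text \<open>Valued in \<open>ennreal\<close>, so that substitution and interchange of integrals need
  no integrability. For \<open>q = 1\<close> and positive parameters it is
  \<open>Gamma a * Tricomi_U a (a - b + 1) \<beta>\<close>.\<close>

definition leaf_integral :: "real \<Rightarrow> real \<Rightarrow> real \<Rightarrow> real \<Rightarrow> ennreal" where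
  "leaf_integral a b \<beta> q =
     (\<integral>\<^sup>+t. ennreal (indicator {0<..} t * (exp (- \<beta> * t) * t powr (a - 1) * (1 + q * t) powr - b)) \<partial>lborel)"

lemma nn_integral_Gamma:
  assumes "0 < s" and "0 < c"
  shows "(\<integral>\<^sup>+t. ennreal (indicator {0<..} t * (exp (- c * t) * t powr (s - 1))) \<partial>lborel) =
    ennreal (Gamma s * c powr - s)"
proof -
  \<comment> \<open>Euler's integrand for \<open>Gamma s\<close>. It lives on the closed half-line,
    but vanishes at \<open>0\<close> since \<open>0 powr x = 0\<close>, so the two indicators agree
    after scaling.\<close>
  let ?g = "\<lambda>t::real. ennreal (indicator {0..} t * t powr (s - 1) / exp t)"
  have "?g (0 + c * t) =
      ennreal (c powr (s - 1)) * ennreal (indicator {0<..} t * (exp (- c * t) * t powr (s - 1)))" for t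
    using assms(2)
    by (auto simp: indicator_def powr_mult exp_minus field_simps zero_le_mult_iff
        simp flip: ennreal_mult')
  then have "ennreal (Gamma s) = ennreal c * (ennreal (c powr (s - 1)) *
      (\<integral>\<^sup>+t. ennreal (indicator {0<..} t * (exp (- c * t) * t powr (s - 1))) \<partial>lborel))"
    unfolding Gamma_conv_nn_integral_real[OF assms(1)]
    using assms(2) by (subst nn_integral_real_affine[where c = c and t = 0]) (simp_all add: nn_integral_cmult)
  also have "\<dots> = ennreal (c powr s) *
      (\<integral>\<^sup>+t. ennreal (indicator {0<..} t * (exp (- c * t) * t powr (s - 1))) \<partial>lborel)"
    using assms(2) by (simp add: mult.assoc[symmetric] ennreal_mult'[symmetric] powr_diff)
  finally have "ennreal (c powr - s) * ennreal (Gamma s) = ennreal (c powr - s * c powr s) *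
      (\<integral>\<^sup>+t. ennreal (indicator {0<..} t * (exp (- c * t) * t powr (s - 1))) \<partial>lborel)"
    by (simp add: ennreal_mult' mult.assoc)
  then show ?thesis
    using assms by (simp add: powr_minus ennreal_mult'[symmetric] mult.commute)
qed

text \<open>Since \<open>b > 0\<close>, the factor \<open>(1 + q * t) powr - b\<close> is at most
  \<open>1\<close>, and a convergent Gamma integral dominates.\<close>

lemma leaf_integral_less_top:
  assumes "0 < a" and "0 < b" and "0 < \<beta>" and "0 \<le> q"
  shows "leaf_integral a b \<beta> q < \<infinity>"
proof -
  have "leaf_integral a b \<beta> q \<le>
      (\<integral>\<^sup>+t. ennreal (indicator {0<..} t * (exp (- \<beta> * t) * t powr (a - 1))) \<partial>lborel)"
    unfolding leaf_integral_def
  proof (intro nn_integral_mono ennreal_leI)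
    fix t :: real
    have "(1 + q * t) powr - b \<le> 1" if "0 < t"
      using that assms by (simp add: powr_minus ge_one_powr_ge_zero inverse_le_1_iff)
    then show "indicator {0<..} t * (exp (- \<beta> * t) * t powr (a - 1) * (1 + q * t) powr - b) \<le>
        indicator {0<..} t * (exp (- \<beta> * t) * t powr (a - 1))"
      by (auto simp: indicator_def mult_left_le)
  qed
  also have "\<dots> < \<infinity>"
    using nn_integral_Gamma[OF assms(1,3)] by simp
  finally show ?thesis .
qed

lemma leaf_integral_pos:
  assumes "0 \<le> q"
  shows "0 < leaf_integral a b \<beta> q"
proof -
  let ?f = "\<lambda>t::real. ennreal (indicator {0<..} t * (exp (- \<beta> * t) * t powr (a - 1) * (1 + q * t) powr - b))"
  have "\<not> (AE t in lborel. ?f t = 0)"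
  proof
    assume "AE t in lborel. ?f t = 0"
    \<comment> \<open>The integrand is positive on the unit interval, so a vanishing integral would
      make that interval a null set.\<close>
    then have "AE t in lborel. t \<notin> {0<..<1::real}"
    proof eventually_elim
      case (elim t)
      have "0 < 1 + q * t" if "0 < t"
        using that assms by (simp add: add_pos_nonneg)
      then show ?case
        using elim by (auto simp: indicator_def ennreal_eq_0_iff mult_le_0_iff)
    qed
    then have "emeasure lborel {0<..<1::real} = 0"
      by (subst (asm) AE_iff_measurable[where N = "{0<..<1}"]) auto
    then show False
      by simp
  qed
  moreover have "?f \<in> borel_measurable lborel"
    by measurable
  ultimately have "leaf_integral a b \<beta> q \<noteq> 0"
    unfolding leaf_integral_def by (subst nn_integral_0_iff_AE)
  then show ?thesis
    by (simp add: zero_less_iff_neq_zero)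
qed

text \<open>Substituting \<open>q * t\<close> for \<open>t\<close> moves \<open>q\<close> into the
  exponential rate; the Jacobian \<open>q\<close> and the power \<open>q powr (a - 1)\<close>
  combine to \<open>q powr a\<close>.\<close>

lemma leaf_integral_scale:
  assumes "0 < q"
  shows "leaf_integral a b \<beta> q = ennreal (q powr - a) * leaf_integral a b (\<beta> / q) 1"
proof -
  let ?f = "\<lambda>t::real. ennreal (indicator {0<..} t * (exp (- (\<beta> / q) * t) * t powr (a - 1) * (1 + 1 * t) powr - b))"
  let ?g = "\<lambda>t::real. ennreal (indicator {0<..} t * (exp (- \<beta> * t) * t powr (a - 1) * (1 + q * t) powr - b))"
  have "?f (0 + q * t) = ennreal (q powr (a - 1)) * ?g t" for t
    using assms by (auto simp: indicator_def powr_mult zero_less_mult_iff mult_ac simp flip: ennreal_mult')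
  then have "leaf_integral a b (\<beta> / q) 1 = ennreal q * (ennreal (q powr (a - 1)) * leaf_integral a b \<beta> q)"
    unfolding leaf_integral_def
    using assms by (subst nn_integral_real_affine[where c = q and t = 0]) (simp_all add: nn_integral_cmult)
  also have "\<dots> = ennreal (q powr a) * leaf_integral a b \<beta> q"
    using assms by (simp add: mult.assoc[symmetric] ennreal_mult'[symmetric] powr_diff)
  finally show ?thesis
    using assms by (simp add: mult.assoc[symmetric] ennreal_mult'[symmetric] powr_minus)
qed

text \<open>The Lebesgue integral in \<open>Tricomi_U\<close> is \<open>enn2real\<close> of the leaf
  integral. Finiteness makes this reversible, and strict positivity carries over to
  \<open>Tricomi_U\<close>.\<close>

lemma leaf_integral_Tricomi:
  assumes "0 < a" and "0 < b" and "0 < z"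
  shows "leaf_integral a b z 1 = ennreal (Gamma a * Tricomi_U a (a - b + 1) z)"
    and "0 < Tricomi_U a (a - b + 1) z"
proof -
  let ?f = "\<lambda>t::real. indicator {0<..} t * (exp (- z * t) * t powr (a - 1) * (1 + 1 * t) powr - b)"
  have "Gamma a * Tricomi_U a (a - b + 1) z = integral\<^sup>L lborel ?f"
    using Gamma_real_pos[OF assms(1)] by (simp add: Tricomi_U_def set_lebesgue_integral_def)
  also have "\<dots> = enn2real (leaf_integral a b z 1)"
    unfolding leaf_integral_def by (rule integral_eq_nn_integral) auto
  finally have *: "Gamma a * Tricomi_U a (a - b + 1) z = enn2real (leaf_integral a b z 1)" .
  then show "leaf_integral a b z 1 = ennreal (Gamma a * Tricomi_U a (a - b + 1) z)"
    using leaf_integral_less_top[OF assms, of 1] by simp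
  have "0 < enn2real (leaf_integral a b z 1)"
    using leaf_integral_less_top[OF assms, of 1] leaf_integral_pos[of 1 a b z]
    by (simp add: enn2real_positive_iff)
  then show "0 < Tricomi_U a (a - b + 1) z"
    using Gamma_real_pos[OF assms(1)] by (simp add: zero_less_mult_iff flip: *)
qed

text \<open>
  Writing the power of \<open>1 + q t\<close> as a Gamma integral gives a double integral that is symmetric
  in \<open>(a, t)\<close> and \<open>(b, s)\<close>.
\<close>

lemma leaf_integral_swap:
  assumes "0 < a" and "0 < b" and "0 < \<beta>" and "0 \<le> q"
  shows "ennreal (Gamma b * \<beta> powr - b) * leaf_integral a b \<beta> q =
    ennreal (Gamma a * \<beta> powr - a) * leaf_integral b a \<beta> q"
proof -
  define h :: "real \<Rightarrow> real \<Rightarrow> real \<Rightarrow> real \<Rightarrow> ennreal" where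
    "h a b t s = ennreal (indicator {0<..} t * indicator {0<..} s *
       (exp (- \<beta> * (t + s + q * t * s)) * t powr (a - 1) * s powr (b - 1)))" for a b t s
  have *: "ennreal (Gamma b * \<beta> powr - b) * leaf_integral a b \<beta> q =
      (\<integral>\<^sup>+t. \<integral>\<^sup>+s. h a b t s \<partial>lborel \<partial>lborel)" if "0 < b" for a b
  proof -
    have "(\<integral>\<^sup>+s. h a b t s \<partial>lborel) = ennreal (Gamma b * \<beta> powr - b) *
        ennreal (indicator {0<..} t * (exp (- \<beta> * t) * t powr (a - 1) * (1 + q * t) powr - b))" for t
    proof (cases "0 < t")
      case True
      \<comment> \<open>The exponent \<open>\<beta> * (t + s + q * t * s)\<close> is
        \<open>\<beta> * t + ?c * s\<close>, so the inner integral is a Gamma integral of rate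
        \<open>?c\<close>.\<close>
      let ?c = "\<beta> * (1 + q * t)"
      have "0 < 1 + q * t"
        using True assms(4) by (simp add: add_pos_nonneg)
      then have c: "0 < ?c"
        using assms(3) by simp
      have "h a b t s = ennreal (exp (- \<beta> * t) * t powr (a - 1)) *
          ennreal (indicator {0<..} s * (exp (- ?c * s) * s powr (b - 1)))" for s
        using True by (auto simp: h_def indicator_def algebra_simps exp_add[symmetric] simp flip: ennreal_mult')
      then have "(\<integral>\<^sup>+s. h a b t s \<partial>lborel) =
          ennreal (exp (- \<beta> * t) * t powr (a - 1)) * ennreal (Gamma b * ?c powr - b)"
        using nn_integral_Gamma[OF that c] by (simp add: nn_integral_cmult)
      also have "?c powr - b = \<beta> powr - b * (1 + q * t) powr - b"
        using assms(3) \<open>0 < 1 + q * t\<close> by (simp add: powr_mult)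
      finally show ?thesis
        using True Gamma_real_pos[OF that] by (simp add: ennreal_mult'[symmetric] mult_ac)
    qed (simp add: h_def)
    then show ?thesis
      unfolding leaf_integral_def by (simp add: nn_integral_cmult)
  qed
  have "(\<integral>\<^sup>+t. \<integral>\<^sup>+s. h a b t s \<partial>lborel \<partial>lborel) = (\<integral>\<^sup>+s. \<integral>\<^sup>+t. h a b t s \<partial>lborel \<partial>lborel)"
    unfolding h_def by (rule lborel_pair.Fubini') measurable
  \<comment> \<open>The kernel is unchanged when \<open>(a, t)\<close> and \<open>(b, s)\<close> are
    exchanged.\<close>
  also have "\<dots> = (\<integral>\<^sup>+s. \<integral>\<^sup>+t. h b a s t \<partial>lborel \<partial>lborel)"
    by (simp add: h_def mult_ac add_ac)
  finally show ?thesis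
    using * assms(1,2) by metis
qed

text \<open>The case \<open>q = 1\<close> of the swap, with the Gamma factors cancelled. In terms of
  \<gamma> = \<open>a - b + 1\<close>, this is the classical relation between U(a, \<gamma>, z) and
  U(a - \<gamma> + 1, 2 - \<gamma>, z).\<close>

lemma Tricomi_U_Kummer_transformation:
  assumes "0 < a" and "0 < b" and "0 < z"
  shows "Tricomi_U b (b - a + 1) z = z powr (a - b) * Tricomi_U a (a - b + 1) z"
proof -
  have pos: "0 < Gamma a" "0 < Gamma b" "0 < z powr - a" "0 < z powr - b"
      "0 < Tricomi_U a (a - b + 1) z" "0 < Tricomi_U b (b - a + 1) z"
    using assms Gamma_real_pos leaf_integral_Tricomi(2) by auto
  have "ennreal (Gamma b * z powr - b * (Gamma a * Tricomi_U a (a - b + 1) z)) =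
      ennreal (Gamma a * z powr - a * (Gamma b * Tricomi_U b (b - a + 1) z))"
    using leaf_integral_swap[OF assms, of 1] leaf_integral_Tricomi(1)[OF assms]
      leaf_integral_Tricomi(1)[OF assms(2,1,3)] pos
    by (simp add: ennreal_mult'[symmetric])
  then have "Gamma b * z powr - b * (Gamma a * Tricomi_U a (a - b + 1) z) =
      Gamma a * z powr - a * (Gamma b * Tricomi_U b (b - a + 1) z)"
    using pos by (subst (asm) ennreal_inj) auto
  then have "z powr - b * Tricomi_U a (a - b + 1) z = z powr - a * Tricomi_U b (b - a + 1) z"
    using pos(1,2) by simp
  then show ?thesis
    using assms(3) by (simp add: powr_diff powr_minus field_simps)
qed

text \<open>The real number multiplying the leaf integral is what a new leaf contributes to the
  claimed constant, so each induction step preserves the normalization.\<close>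

lemma leaf_integral_edge_factor:
  assumes "0 < a" and "0 < b" and "0 < \<beta>" and "0 < q"
  shows "leaf_integral a b \<beta> q * ennreal (\<beta> powr ((a - b) / 2) / Gamma a *
    sqrt (q powr (a + b) / (Tricomi_U a (a - b + 1) (\<beta> / q) * Tricomi_U b (b - a + 1) (\<beta> / q)))) = 1"
proof -
  let ?z = "\<beta> / q"
  define u where "u = Tricomi_U a (a - b + 1) ?z"
  have z: "0 < ?z"
    using assms by simp
  have u: "0 < u"
    unfolding u_def using leaf_integral_Tricomi(2)[OF assms(1,2) z] .
  have G: "0 < Gamma a"
    using Gamma_real_pos assms(1) .
  have sqrt_powr: "sqrt (x powr y) = x powr (y / 2)" for x y :: real
    by (rule real_sqrt_unique) (simp_all add: power2_eq_square flip: powr_add)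
  \<comment> \<open>Both Tricomi values become multiples of \<open>u\<close>, so the denominator
    under the root is the square of \<open>u\<close> times a power of \<open>?z\<close>, and the
    root resolves.\<close>
  have "Tricomi_U b (b - a + 1) ?z = ?z powr (a - b) * u"
    unfolding u_def using Tricomi_U_Kummer_transformation[OF assms(1,2) z] .
  then have "sqrt (q powr (a + b) / (u * Tricomi_U b (b - a + 1) ?z)) =
      q powr ((a + b) / 2) / (?z powr ((a - b) / 2) * u)"
    using u by (simp add: real_sqrt_divide real_sqrt_mult sqrt_powr)
  also have "?z powr ((a - b) / 2) = \<beta> powr ((a - b) / 2) / q powr ((a - b) / 2)"
    using assms by (simp add: powr_divide)
  finally have "q powr - a * (Gamma a * u) * (\<beta> powr ((a - b) / 2) / Gamma a *
      sqrt (q powr (a + b) / (u * Tricomi_U b (b - a + 1) ?z))) =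
      q powr - a * (q powr ((a + b) / 2) * q powr ((a - b) / 2))"
    using assms u less_imp_neq[OF G] by simp
  also have "\<dots> = 1"
    using assms by (simp add: add_divide_distrib diff_divide_distrib flip: powr_add)
  finally have *: "q powr - a * (Gamma a * u) * (\<beta> powr ((a - b) / 2) / Gamma a *
      sqrt (q powr (a + b) / (u * Tricomi_U b (b - a + 1) ?z))) = 1" .
  have "leaf_integral a b \<beta> q = ennreal (q powr - a * (Gamma a * u))"
    unfolding leaf_integral_scale[OF assms(4)] leaf_integral_Tricomi(1)[OF assms(1,2) z] u_def
    by (simp add: ennreal_mult')
  then show ?thesis
    using * u G by (simp add: ennreal_mult'[symmetric] flip: u_def)
qed

section \<open>The tree-Kummer normalizing constant\<close>

lemma measurable_Delta_Kum [measurable]: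
  "Delta_Kum V E q \<in> borel_measurable (\<Pi>\<^sub>M v\<in>V. lborel)"
proof -
  have "(\<lambda>k. k v) \<in> borel_measurable (\<Pi>\<^sub>M v\<in>V. lborel :: real measure)" if "v \<in> W" "W \<subseteq> V" for v W
    using measurable_component_singleton[of v V "\<lambda>_. lborel"] that by auto
  then show ?thesis
    unfolding Delta_Kum_def
    by (intro borel_measurable_sum borel_measurable_times borel_measurable_const borel_measurable_prod) blast
qed

lemma measurable_tree_Kummer_weight [measurable]:
  assumes "finite V"
  shows "tree_Kummer_weight V E a \<beta> q \<in> borel_measurable (\<Pi>\<^sub>M v\<in>V. lborel)"
proof -
  have [measurable]: "(\<Pi>\<^sub>E v\<in>V. {0<..}) \<in> sets (\<Pi>\<^sub>M v\<in>V. lborel :: real measure)"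
    using assms by (intro sets_PiM_I_finite) auto
  have [measurable]: "(\<lambda>k. \<Prod>v\<in>V. k v powr (a v - 1)) \<in> borel_measurable (\<Pi>\<^sub>M v\<in>V. lborel :: real measure)"
    by (intro borel_measurable_prod) measurable
  show ?thesis
    unfolding tree_Kummer_weight_def by measurable
qed

lemma tree_Kummer_weight_nonneg: "0 \<le> tree_Kummer_weight V E a \<beta> q k"
  by (simp add: tree_Kummer_weight_def prod_nonneg)

lemma Delta_Kum_cong:
  assumes "\<And>v. v \<in> V \<Longrightarrow> k v = h v"
  shows "Delta_Kum V E q k = Delta_Kum V E q h"
  unfolding Delta_Kum_def using assms by (intro sum.cong arg_cong2[where f = "(*)"] prod.cong refl) auto

text \<open>The weight without \<open>l\<close> is evaluated at \<open>c * x p\<close>, which yields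
  a surplus \<open>c powr (a p - 1)\<close>; the factor \<open>c powr (1 - a p)\<close> cancels it.
  Extensionality of \<open>x\<close> matters because \<open>x(l := y)\<close> forgets the value
  \<open>x l\<close>.\<close>

lemma tree_Kummer_weight_pendant_edge:
  fixes y :: real
  assumes "finite V" and "simple_graph V E" and "l \<notin> V" and "p \<in> V" and "0 < q {l, p}"
    and x: "x \<in> extensional V"
  defines "c \<equiv> 1 + q {l, p} * y"
  shows "tree_Kummer_weight (insert l V) (insert {l, p} E) a \<beta> q (x(l := y)) =
    indicator {0<..} y * (exp (- \<beta> * y) * y powr (a l - 1) * c powr (1 - a p)) *
    tree_Kummer_weight V E a \<beta> q (x(p := c * x p))"
proof (cases "0 < y \<and> x \<in> (\<Pi>\<^sub>E v\<in>V. {0<..})")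
  case True
  then have xV: "0 < x v" if "v \<in> V" for v
    using that by auto
  have "0 < y" and c: "0 < c"
    using True assms(5) by (auto simp: c_def add_pos_pos)
  have "p \<noteq> l"
    using assms(3,4) by blast
  have "Delta_Kum (insert l V) (insert {l, p} E) q (x(l := y)) =
      y + Delta_Kum V E q (x(p := c * x p))"
    unfolding Delta_Kum_pendant_edge[OF assms(1-4)]
    using assms(3) \<open>p \<noteq> l\<close> by (auto simp: c_def intro!: Delta_Kum_cong)
  moreover have "(\<Prod>v\<in>insert l V. (x(l := y)) v powr (a v - 1)) =
      y powr (a l - 1) * (\<Prod>v\<in>V. x v powr (a v - 1))"
  proof -
    have "(\<Prod>v\<in>V. (x(l := y)) v powr (a v - 1)) = (\<Prod>v\<in>V. x v powr (a v - 1))"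
      using assms(3) by (intro prod.cong) auto
    then show ?thesis
      using assms(1,3) by simp
  qed
  moreover have "(\<Prod>v\<in>V. (x(p := c * x p)) v powr (a v - 1)) =
      c powr (a p - 1) * (\<Prod>v\<in>V. x v powr (a v - 1))"
  proof -
    \<comment> \<open>Writing the change at \<open>p\<close> as a conditional factor lets it be
      split off the product.\<close>
    have "(\<Prod>v\<in>V. (x(p := c * x p)) v powr (a v - 1)) =
        (\<Prod>v\<in>V. (if v = p then c powr (a v - 1) else 1) * x v powr (a v - 1))"
      using c xV by (intro prod.cong) (auto simp: powr_mult)
    then show ?thesis
      using assms(1,4) by (simp add: prod.distrib)
  qed
  moreover have "x(l := y) \<in> (\<Pi>\<^sub>E v\<in>insert l V. {0<..})"
    using True by (auto simp: PiE_iff extensional_def)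
  moreover have "x(p := c * x p) \<in> (\<Pi>\<^sub>E v\<in>V. {0<..})"
    using True c assms(4) by (auto simp: PiE_iff extensional_def)
  moreover have "c powr (1 - a p) * (c powr (a p - 1) * r) = r" for r
    using c by (simp flip: powr_add mult.assoc)
  moreover have "exp (- \<beta> * (y + r)) = exp (- \<beta> * y) * exp (- \<beta> * r)" for r
    by (simp add: algebra_simps flip: exp_add)
  ultimately show ?thesis
    using \<open>0 < y\<close> by (simp add: tree_Kummer_weight_def mult_ac)
next
  case False
  \<comment> \<open>Outside the support both sides vanish: for \<open>y > 0\<close> the scale
    \<open>c\<close> is positive and preserves signs, and otherwise the indicator of
    \<open>y\<close> is zero.\<close>
  have "x(p := c * x p) \<notin> (\<Pi>\<^sub>E v\<in>V. {0<..})" if "0 < y"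
  proof
    assume *: "x(p := c * x p) \<in> (\<Pi>\<^sub>E v\<in>V. {0<..})"
    have "0 < c"
      using that assms(5) by (simp add: c_def add_pos_pos)
    have "0 < x v" if "v \<in> V" for v
      using PiE_mem[OF * that] \<open>0 < c\<close> by (cases "v = p") (auto simp: zero_less_mult_iff)
    then show False
      using False that x by (auto simp: PiE_iff)
  qed
  moreover have "x(l := y) \<notin> (\<Pi>\<^sub>E v\<in>insert l V. {0<..})"
  proof
    assume *: "x(l := y) \<in> (\<Pi>\<^sub>E v\<in>insert l V. {0<..})"
    have "0 < y"
      using PiE_mem[OF *, of l] by simp
    moreover have "0 < x v" if "v \<in> V" for v
      using PiE_mem[OF *, of v] that assms(3) by (auto split: if_splits)
    ultimately show False
      using False x by (auto simp: PiE_iff)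
  qed
  ultimately show ?thesis
    by (auto simp: tree_Kummer_weight_def indicator_def)
qed

text \<open>Splitting off the coordinate \<open>i\<close> reduces the claim to the one-dimensional
  linear substitution.\<close>

lemma nn_integral_PiM_lborel_scale:
  fixes c :: real
  assumes "finite I" and "i \<in> I" and "0 < c"
    and f [measurable]: "f \<in> borel_measurable (\<Pi>\<^sub>M i\<in>I. lborel)"
  shows "(\<integral>\<^sup>+x. f (x(i := c * x i)) \<partial>(\<Pi>\<^sub>M i\<in>I. lborel)) =
    ennreal (1 / c) * (\<integral>\<^sup>+x. f x \<partial>(\<Pi>\<^sub>M i\<in>I. lborel))"
proof -
  interpret product_sigma_finite "\<lambda>_. lborel :: real measure"
    by standard
  define J where "J = I - {i}"
  have I: "I = insert i J" and J: "finite J" "i \<notin> J"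
    using assms(1,2) by (auto simp: J_def)
  let ?M = "\<Pi>\<^sub>M i\<in>I. lborel :: real measure"
  have upd [measurable]: "(\<lambda>x. x(i := c * x i)) \<in> ?M \<rightarrow>\<^sub>M ?M"
    using assms(2) by (intro measurable_fun_upd[where J = I]) auto
  have inner: "(\<integral>\<^sup>+y. f (x(i := y)) \<partial>lborel) = ennreal c * (\<integral>\<^sup>+y. f (x(i := c * y)) \<partial>lborel)"
    if "x \<in> space (\<Pi>\<^sub>M i\<in>J. lborel)" for x
  proof -
    have "(\<lambda>y. f (x(i := y))) \<in> borel_measurable borel"
      using measurable_compose[OF measurable_fun_upd[of "insert i J" J i "\<lambda>_. x" borel "\<lambda>_. lborel" "\<lambda>y. y"] f[unfolded I]]
        that by simp
    then show ?thesis
      using assms(3) by (subst nn_integral_real_affine[where c = c and t = 0]) auto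
  qed
  have "(\<integral>\<^sup>+x. f x \<partial>?M) = (\<integral>\<^sup>+x. \<integral>\<^sup>+y. f (x(i := y)) \<partial>lborel \<partial>(\<Pi>\<^sub>M i\<in>J. lborel))"
    using f unfolding I by (rule product_nn_integral_insert[OF J])
  also have "\<dots> = (\<integral>\<^sup>+x. ennreal c * (\<integral>\<^sup>+y. f (x(i := c * y)) \<partial>lborel) \<partial>(\<Pi>\<^sub>M i\<in>J. lborel))"
    using inner by (intro nn_integral_cong) auto
  also have "\<dots> = ennreal c * (\<integral>\<^sup>+x. \<integral>\<^sup>+y. f (x(i := c * y)) \<partial>lborel \<partial>(\<Pi>\<^sub>M i\<in>J. lborel))"
  proof (rule nn_integral_cmult)
    have "(\<lambda>(x, y). x(i := c * y)) \<in> (\<Pi>\<^sub>M i\<in>J. lborel) \<Otimes>\<^sub>M lborel \<rightarrow>\<^sub>M ?M"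
      unfolding I case_prod_beta by (intro measurable_fun_upd[where J = J]) auto
    then have "(\<lambda>(x, y). f (x(i := c * y))) \<in> borel_measurable ((\<Pi>\<^sub>M i\<in>J. lborel) \<Otimes>\<^sub>M lborel)"
      using measurable_compose[OF _ f] by (simp add: case_prod_beta)
    then show "(\<lambda>x. \<integral>\<^sup>+y. f (x(i := c * y)) \<partial>lborel) \<in> borel_measurable (\<Pi>\<^sub>M i\<in>J. lborel)"
      by (rule lborel.borel_measurable_nn_integral)
  qed
  also have "(\<integral>\<^sup>+x. \<integral>\<^sup>+y. f (x(i := c * y)) \<partial>lborel \<partial>(\<Pi>\<^sub>M i\<in>J. lborel)) =
      (\<integral>\<^sup>+x. f (x(i := c * x i)) \<partial>?M)"
    using measurable_compose[OF upd f] unfolding I by (subst product_nn_integral_insert[OF J]) simp_all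
  finally show ?thesis
    using assms(3) by (simp add: mult.assoc[symmetric] ennreal_mult'[symmetric])
qed

section \<open>Recursion for the total mass\<close>

text \<open>The total mass of the unnormalized weight, kept in \<open>ennreal\<close> so that its
  recursion holds before finiteness is known.\<close>

definition Kummer_partition ::
  "'v set \<Rightarrow> 'v set set \<Rightarrow> ('v \<Rightarrow> real) \<Rightarrow> real \<Rightarrow> ('v set \<Rightarrow> real) \<Rightarrow> ennreal" where
  "Kummer_partition V E a \<beta> q =
     (\<integral>\<^sup>+k. ennreal (tree_Kummer_weight V E a \<beta> q k) \<partial>(\<Pi>\<^sub>M v\<in>V. lborel))"

text \<open>With the leaf variable \<open>y\<close> fixed, the scale of \<open>x p\<close> is a
  constant. Its Jacobian \<open>1 / c\<close> turns \<open>c powr (1 - a p)\<close> into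
  \<open>c powr - a p\<close>, and the remaining integral over \<open>y\<close> is the leaf
  integral.\<close>

lemma Kummer_partition_pendant_edge:
  assumes "finite V" and "simple_graph V E" and "l \<notin> V" and "p \<in> V" and "0 < q {l, p}"
  shows "Kummer_partition (insert l V) (insert {l, p} E) a \<beta> q =
    leaf_integral (a l) (a p) \<beta> (q {l, p}) * Kummer_partition V E a \<beta> q"
proof -
  interpret product_sigma_finite "\<lambda>_. lborel :: real measure"
    by standard
  let ?M = "\<Pi>\<^sub>M v\<in>V. lborel :: real measure"
  let ?w = "tree_Kummer_weight (insert l V) (insert {l, p} E) a \<beta> q"
  let ?g = "\<lambda>y. indicator {0<..} y *
    (exp (- \<beta> * y) * y powr (a l - 1) * (1 + q {l, p} * y) powr - a p)"
  have meas: "(\<lambda>k. ennreal (tree_Kummer_weight V E a \<beta> q k)) \<in> borel_measurable ?M"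
    using measurable_tree_Kummer_weight[OF assms(1)] by measurable
  have inner: "(\<integral>\<^sup>+x. ennreal (?w (x(l := y))) \<partial>?M) = ennreal (?g y) * Kummer_partition V E a \<beta> q" for y
  proof -
    define c where "c = 1 + q {l, p} * y"
    define s where "s = indicator {0<..} y * (exp (- \<beta> * y) * y powr (a l - 1) * c powr (1 - a p))"
    have "0 \<le> s"
      by (simp add: s_def)
    have "?w (x(l := y)) = s * tree_Kummer_weight V E a \<beta> q (x(p := c * x p))" if "x \<in> space ?M" for x
      using tree_Kummer_weight_pendant_edge[of V E l p q x a \<beta> y] assms that
      by (simp add: s_def c_def space_PiM PiE_def)
    then have "(\<integral>\<^sup>+x. ennreal (?w (x(l := y))) \<partial>?M) =
        (\<integral>\<^sup>+x. ennreal s * ennreal (tree_Kummer_weight V E a \<beta> q (x(p := c * x p))) \<partial>?M)"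
      using \<open>0 \<le> s\<close> by (intro nn_integral_cong) (simp add: ennreal_mult')
    also have "\<dots> = ennreal (?g y) * Kummer_partition V E a \<beta> q"
    \<comment> \<open>The scale \<open>c\<close> is known to be positive only for
      \<open>y > 0\<close>; otherwise \<open>s\<close> and the right-hand side are both
      zero.\<close>
    proof (cases "0 < y")
      case True
      then have c: "0 < c"
        using assms(5) by (simp add: c_def add_pos_pos)
      have "(\<lambda>x. x(p := c * x p)) \<in> ?M \<rightarrow>\<^sub>M ?M"
        using assms(4) by (intro measurable_fun_upd[where J = V]) auto
      then have "(\<integral>\<^sup>+x. ennreal s * ennreal (tree_Kummer_weight V E a \<beta> q (x(p := c * x p))) \<partial>?M) =
          ennreal s * (ennreal (1 / c) * Kummer_partition V E a \<beta> q)"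
        unfolding Kummer_partition_def nn_integral_PiM_lborel_scale[OF assms(1,4) c meas, symmetric]
        by (intro nn_integral_cmult measurable_compose[OF _ meas])
      also have "\<dots> = ennreal (s * (1 / c)) * Kummer_partition V E a \<beta> q"
        by (simp only: ennreal_mult'[OF \<open>0 \<le> s\<close>] mult.assoc)
      also have "s * (1 / c) = ?g y"
        using c by (simp add: s_def c_def powr_diff powr_minus divide_inverse)
      finally show ?thesis .
    qed (simp add: s_def)
    finally show ?thesis .
  qed
  have "Kummer_partition (insert l V) (insert {l, p} E) a \<beta> q =
      (\<integral>\<^sup>+y. \<integral>\<^sup>+x. ennreal (?w (x(l := y))) \<partial>?M \<partial>lborel)"
    unfolding Kummer_partition_def
    using measurable_tree_Kummer_weight[of "insert l V"] assms(1,3)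
    \<comment> \<open>The reversed order makes the coordinates in \<open>V\<close> the inner
      variables and \<open>y\<close> the outer one.\<close>
    by (intro product_nn_integral_insert_rev) auto
  also have "\<dots> = (\<integral>\<^sup>+y. ennreal (?g y) * Kummer_partition V E a \<beta> q \<partial>lborel)"
    using inner by simp
  also have "\<dots> = leaf_integral (a l) (a p) \<beta> (q {l, p}) * Kummer_partition V E a \<beta> q"
    unfolding leaf_integral_def by (rule nn_integral_multc) measurable
  finally show ?thesis .
qed

lemma Kummer_partition_singleton:
  assumes "0 < a v" and "0 < \<beta>"
  shows "Kummer_partition {v} {} a \<beta> q = ennreal (Gamma (a v) * \<beta> powr - a v)"
proof -
  interpret product_sigma_finite "\<lambda>_. lborel :: real measure"
    by standard
  let ?f = "\<lambda>t::real. ennreal (indicator {0<..} t * (exp (- \<beta> * t) * t powr (a v - 1)))"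
  have "Kummer_partition {v} {} a \<beta> q = (\<integral>\<^sup>+k. ?f (k v) \<partial>(\<Pi>\<^sub>M v\<in>{v}. lborel))"
    unfolding Kummer_partition_def
    by (intro nn_integral_cong)
      (auto simp: tree_Kummer_weight_def Delta_Kum_singleton space_PiM PiE_iff indicator_def)
  also have "\<dots> = (\<integral>\<^sup>+t. ?f t \<partial>lborel)"
    by (rule product_nn_integral_singleton) measurable
  finally show ?thesis
    using nn_integral_Gamma[OF assms] by simp
qed

section \<open>The closed form and the normalization\<close>

lemma vertex_degree_insert:
  assumes "finite E" and "e \<notin> E"
  shows "vertex_degree (insert e E) v = vertex_degree E v + (if v \<in> e then 1 else 0)"
proof -
  have "{f \<in> insert e E. v \<in> f} = (if v \<in> e then insert e {f \<in> E. v \<in> f} else {f \<in> E. v \<in> f})"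
    by auto
  then show ?thesis
    using assms by (simp add: vertex_degree_def)
qed

definition Kummer_constant ::
  "'v set \<Rightarrow> 'v set set \<Rightarrow> ('v \<Rightarrow> real) \<Rightarrow> real \<Rightarrow> ('v set \<Rightarrow> real) \<Rightarrow> real" where
  "Kummer_constant V E a \<beta> q =
     (\<Prod>v\<in>V. \<beta> powr (a v * (1 - real (vertex_degree E v) / 2)) / Gamma (a v)) *
     (\<Prod>e\<in>E. Kummer_edge_factor a \<beta> q e)"

text \<open>The leaf has degree one and contributes \<open>\<beta> powr (a l / 2)\<close>; the
  degree of \<open>p\<close> grows by one, which costs \<open>\<beta> powr (a p / 2)\<close>. This
  explains the half degrees in the exponent.\<close>

lemma Kummer_constant_pendant_edge:
  assumes "finite V" and "simple_graph V E" and "l \<notin> V" and "p \<in> V" and "0 < \<beta>"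
  shows "Kummer_constant (insert l V) (insert {l, p} E) a \<beta> q =
    \<beta> powr ((a l - a p) / 2) / Gamma (a l) * Kummer_edge_factor a \<beta> q {l, p} *
    Kummer_constant V E a \<beta> q"
proof -
  let ?E = "insert {l, p} E"
  let ?t = "\<lambda>F v. \<beta> powr (a v * (1 - real (vertex_degree F v) / 2)) / Gamma (a v)"
  have l: "\<forall>e\<in>E. l \<notin> e"
    using assms(3) simple_graph_subset[OF assms(2)] by blast
  then have e: "{l, p} \<notin> E"
    by blast
  have finE: "finite E"
    using simple_graph_finite_edges[OF assms(2,1)] .
  have "{e \<in> E. l \<in> e} = {}"
    using l by blast
  then have "vertex_degree E l = 0"
    by (simp only: vertex_degree_def card.empty)
  then have "vertex_degree ?E l = 1"
    using vertex_degree_insert[OF finE e, of l] by simp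
  then have t_l: "?t ?E l = \<beta> powr (a l / 2) / Gamma (a l)"
    by simp
  have t_V: "?t ?E v = (if v = p then \<beta> powr (- (a v / 2)) else 1) * ?t E v" if "v \<in> V" for v
  proof -
    have "v \<in> {l, p} \<longleftrightarrow> v = p"
      using that assms(3) by auto
    then show ?thesis
      using vertex_degree_insert[OF finE e, of v] by (auto simp: algebra_simps add_divide_distrib simp flip: powr_add)
  qed
  have "(\<Prod>v\<in>V. ?t ?E v) =
      (\<Prod>v\<in>V. (if v = p then \<beta> powr (- (a v / 2)) else 1) * ?t E v)"
    using t_V by (rule prod.cong[OF refl])
  also have "\<dots> = \<beta> powr (- (a p / 2)) * (\<Prod>v\<in>V. ?t E v)"
    unfolding prod.distrib using assms(1,4) by simp
  finally have V_prod: "(\<Prod>v\<in>V. ?t ?E v) = \<beta> powr (- (a p / 2)) * (\<Prod>v\<in>V. ?t E v)" .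
  have "(\<Prod>v\<in>insert l V. ?t ?E v) =
      \<beta> powr (a l / 2) / Gamma (a l) * (\<beta> powr (- (a p / 2)) * (\<Prod>v\<in>V. ?t E v))"
    by (simp only: prod.insert[OF assms(1,3)] t_l V_prod)
  also have "\<dots> = \<beta> powr (a l / 2) * \<beta> powr (- (a p / 2)) / Gamma (a l) * (\<Prod>v\<in>V. ?t E v)"
    by (simp only: mult.assoc times_divide_eq_left)
  also have "\<beta> powr (a l / 2) * \<beta> powr (- (a p / 2)) = \<beta> powr ((a l - a p) / 2)"
    by (simp add: diff_divide_distrib flip: powr_add)
  finally show ?thesis
    unfolding Kummer_constant_def prod.insert[OF finE e] by (simp only: mult_ac)
qed

text \<open>Attaching a leaf multiplies the mass and the constant by reciprocal factors. Stated as a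
  product equal to \<open>1\<close> in \<open>ennreal\<close>, the claim includes that the mass is
  finite and nonzero.\<close>

lemma Kummer_partition_times_constant:
  assumes "finite V" and "is_tree V E" and "0 < \<beta>"
    and "\<And>v. v \<in> V \<Longrightarrow> 0 < a v" and "\<And>e. e \<in> E \<Longrightarrow> 0 < q e"
  shows "Kummer_partition V E a \<beta> q * ennreal (Kummer_constant V E a \<beta> q) = 1"
  using assms(1,2,4,5)
proof (induction rule: tree_induct)
  case (singleton v)
  then have "0 < Gamma (a v)" "0 < a v"
    by (auto intro: Gamma_real_pos)
  then show ?case
    using assms(3) Kummer_partition_singleton[of a v \<beta> q] less_imp_neq[of 0 "Gamma (a v)"]
    by (simp add: Kummer_constant_def vertex_degree_def powr_minus flip: ennreal_mult')
next
  case (pendant l p V E)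
  have simple: "simple_graph V E"
    using pendant.hyps(2) by (simp add: is_tree_def)
  have pos: "0 < a l" "0 < a p" "0 < q {l, p}"
    using pendant.prems pendant.hyps(4) by auto
  have "l \<noteq> p"
    using pendant.hyps(3,4) by blast
  define r where "r = \<beta> powr ((a l - a p) / 2) / Gamma (a l) * Kummer_edge_factor a \<beta> q {l, p}"
  have r: "leaf_integral (a l) (a p) \<beta> (q {l, p}) * ennreal r = 1"
    unfolding r_def Kummer_edge_factor_doubleton[OF \<open>l \<noteq> p\<close>]
    by (rule leaf_integral_edge_factor) (use pos assms(3) in auto)
  \<comment> \<open>A negative \<open>r\<close> would be truncated to \<open>0\<close> by
    \<open>ennreal\<close>, contradicting the product \<open>1\<close>.\<close>
  have "0 \<le> r"
    by (rule ccontr) (use r in \<open>simp add: ennreal_neg\<close>)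
  have IH: "Kummer_partition V E a \<beta> q * ennreal (Kummer_constant V E a \<beta> q) = 1"
    using pendant.IH pendant.prems by simp
  have "Kummer_partition (insert l V) (insert {l, p} E) a \<beta> q *
      ennreal (Kummer_constant (insert l V) (insert {l, p} E) a \<beta> q) =
      (leaf_integral (a l) (a p) \<beta> (q {l, p}) * ennreal r) *
      (Kummer_partition V E a \<beta> q * ennreal (Kummer_constant V E a \<beta> q))"
    unfolding Kummer_partition_pendant_edge[of V E l p q, OF pendant.hyps(1) simple pendant.hyps(3,4) pos(3)]
      Kummer_constant_pendant_edge[OF pendant.hyps(1) simple pendant.hyps(3,4) assms(3)] r_def[symmetric]
    using \<open>0 \<le> r\<close> by (simp add: ennreal_mult' mult_ac)
  then show ?case
    using r IH by simp
qed

theorem proposition5p4: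
  fixes V :: "'v set" and E :: "'v set set"
    and a :: "'v \<Rightarrow> real" and \<beta> :: real and q :: "'v set \<Rightarrow> real" and c :: real
  assumes "finite V" and "1 < card V" and "is_tree V E"
    and "\<And>v. v \<in> V \<Longrightarrow> 0 < a v" and "0 < \<beta>" and "\<And>e. e \<in> E \<Longrightarrow> 0 < q e"
  shows "is_tree_Kummer_constant V E a \<beta> q c \<longleftrightarrow>
    c = (\<Prod>v\<in>V. \<beta> powr (a v * (1 - real (vertex_degree E v) / 2)) / Gamma (a v)) *
        (\<Prod>e\<in>E. Kummer_edge_factor a \<beta> q e)"
proof -
  let ?M = "\<Pi>\<^sub>M v\<in>V. lborel :: real measure"
  let ?w = "tree_Kummer_weight V E a \<beta> q"
  define C where "C = Kummer_constant V E a \<beta> q"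
  define Z where "Z = Kummer_partition V E a \<beta> q"
  have ZC: "Z * ennreal C = 1"
    unfolding Z_def C_def using assms by (intro Kummer_partition_times_constant)
  then have "0 < C"
    by (cases "0 < C") (simp_all add: ennreal_neg)
  have meas: "?w \<in> borel_measurable ?M"
    using measurable_tree_Kummer_weight[OF assms(1)] .
  have total: "(\<integral>\<^sup>+k. ennreal (c * ?w k) \<partial>?M) = ennreal c * Z"
  proof (cases "0 \<le> c")
    case True
    then show ?thesis
      unfolding Z_def Kummer_partition_def using meas
      by (subst nn_integral_cmult[symmetric]) (auto simp: ennreal_mult')
  next
    \<comment> \<open>For negative \<open>c\<close> both sides are zero, since
      \<open>ennreal\<close> truncates negative reals.\<close>
    case False
    then have "ennreal (c * ?w k) = 0" for k
      using tree_Kummer_weight_nonneg[of V E a \<beta> q k] by (intro ennreal_neg) (simp add: mult_le_0_iff)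
    then show ?thesis
      using False by (simp add: ennreal_neg)
  qed
  have "is_tree_Kummer_constant V E a \<beta> q c \<longleftrightarrow> c = C"
  proof
    assume "is_tree_Kummer_constant V E a \<beta> q c"
    then have cZ: "ennreal c * Z = 1"
      using total by (simp add: is_tree_Kummer_constant_def is_prob_density_def)
    then have "0 < c"
      by (cases "0 < c") (simp_all add: ennreal_neg)
    \<comment> \<open>Uniqueness of inverses: \<open>c\<close> and \<open>C\<close> both invert
      \<open>Z\<close>.\<close>
    have "ennreal c = ennreal c * (Z * ennreal C)"
      using ZC by simp
    also have "\<dots> = ennreal C"
      using cZ by (simp flip: mult.assoc)
    finally show "c = C"
      using \<open>0 < c\<close> \<open>0 < C\<close> by simp
  next
    assume "c = C"
    moreover have "(\<lambda>k. C * ?w k) \<in> borel_measurable ?M"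
      using meas by measurable
    ultimately show "is_tree_Kummer_constant V E a \<beta> q c"
      using total ZC \<open>0 < C\<close> tree_Kummer_weight_nonneg[of V E a \<beta> q]
      by (simp add: is_tree_Kummer_constant_def is_prob_density_def mult.commute)
  qed
  then show ?thesis
    by (simp add: C_def Kummer_constant_def)
qed

end
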